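(* Let $\{x_{i,n}\}_{1\le i\le n}$ be a locally stationary time series with covariance function $\gamma(t,k)$, satisfying the short-range dependence condition with exponent $\tau>1$ (both defined in the context), and let $$f(t,\omega)=\sum_{j=-\infty}^{\infty}\gamma(t,j)e^{-\mathrm{i}j\omega},\qquad \mathrm{i}=\sqrt{-1}.$$ If there exists a constant $\kappa>0$ such that $f(t,\omega)\ge\kappa$ for all $t\in[0,1]$ and all $\omega$, then $\{x_{i,n}\}$ satisfies the UPDC condition. Conversely, if $\{x_{i,n}\}$ satisfies the UPDC condition (in addition to local stationarity and the short-range dependence condition), then there exists a constant $\kappa>0$ such that $f(t,\omega)\ge\kappa$ for all $t\in[0,1]$ and all $\omega$.
   Context: For each $n$, $x_{1,n},\dots,x_{n,n}$ are real random variables. Locally stationary (in covariance): there is a function $\gamma(t,k):[0,1]\times\mathbb{N}\to\mathbb{R}$ (with $\mathbb{N}\ni 0$, not depending on $n$) such that $$\operatorname{Cov}(x_{i,n},x_{j,n})=\gamma(t_i,|i-j|)+O\Big(\frac{|i-j|+1}{n}\Big),\qquad t_i=\frac in,$$ with the $O$ uniform in $i,j,n$; $\gamma$ is Lipschitz continuous in $t$ (with a Lipschitz constant not depending on $k$); and for any fixed $t\in[0,1]$, $\gamma(t,\cdot)$ is the autocovariance function of a stationary process. For negative lags $\gamma(t,-j)=\gamma(t,j)$. Short-range dependence condition with exponent $\tau>1$: there is a constant $C>0$ independent of $n$ with $|\operatorname{Cov}(x_{k,n},x_{k+r,n})|\le C|r|^{-\tau}$ for all $n$, $1\le k\le n$,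 $-k+1\le r\le n-k$, $r\neq0$; also $\sup_{i,n}\mathbb{E}|x_{i,n}|<\infty$. UPDC condition: there is a universal constant $\kappa>0$ such that for all sufficiently large $n$ the smallest eigenvalue of the covariance matrix $\operatorname{Cov}(x_{1,n},\dots,x_{n,n})$ is at least $\kappa$. *)

theory Defs
  imports
    "HOL-Probability.Probability"
    "HOL-Library.Complex_Order"
    "Jordan_Normal_Form.Spectral_Radius"
begin

definition covariance :: "'a measure \<Rightarrow> ('a \<Rightarrow> real) \<Rightarrow> ('a \<Rightarrow> real) \<Rightarrow> real" where
  "covariance P X Y =
     (\<integral>\<omega>. (X \<omega> - (\<integral>\<eta>. X \<eta> \<partial>P)) * (Y \<omega> - (\<integral>\<eta>. Y \<eta> \<partial>P)) \<partial>P)"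

text \<open>
  Throughout, \<open>x i n\<close> is the random variable $x_{i,n}$, $1 \le i \le n$; the values of \<open>x i n\<close>
  for other \<open>i\<close> are irrelevant. The \<open>n\<close>-th row lives on its own probability space \<open>M n\<close>. Square
  integrability is what makes all the covariances meaningful.
\<close>

definition triangular_array ::
    "(nat \<Rightarrow> 'a measure) \<Rightarrow> (nat \<Rightarrow> nat \<Rightarrow> 'a \<Rightarrow> real) \<Rightarrow> bool" where
  "triangular_array M x \<longleftrightarrow>
     (\<forall>n. prob_space (M n) \<and>
        (\<forall>i\<in>{1..n}. x i n \<in> borel_measurable (M n) \<and> integrable (M n) (\<lambda>\<omega>. (x i n \<omega>)\<^sup>2)))"

definition stationary_process :: "'b measure \<Rightarrow> (int \<Rightarrow> 'b \<Rightarrow> real) \<Rightarrow> bool" where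
  "stationary_process P X \<longleftrightarrow>
     prob_space P \<and>
     (\<forall>s. X s \<in> borel_measurable P \<and> integrable P (\<lambda>\<omega>. (X s \<omega>)\<^sup>2)) \<and>
     (\<forall>s h. (\<integral>\<omega>. X (s + h) \<omega> \<partial>P) = (\<integral>\<omega>. X s \<omega> \<partial>P)) \<and>
     (\<forall>s t h. covariance P (X (s + h)) (X (t + h)) = covariance P (X s) (X t))"

text \<open>
  Existence of a stationary process with a given autocovariance function. Restricting the
  sample space to the path space \<open>int \<Rightarrow> real\<close> loses nothing: a process on any
  probability space may be replaced by the coordinate process under its law.
\<close>

definition stationary_autocovariance :: "(nat \<Rightarrow> real) \<Rightarrow> bool" where
  "stationary_autocovariance g \<longleftrightarrow>
     (\<exists>(P :: (int \<Rightarrow> real) measure) X. stationary_process P X \<and>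
        (\<forall>s k. covariance P (X s) (X (s + int k)) = g k))"

definition locally_stationary ::
    "(nat \<Rightarrow> 'a measure) \<Rightarrow> (nat \<Rightarrow> nat \<Rightarrow> 'a \<Rightarrow> real) \<Rightarrow> (real \<Rightarrow> nat \<Rightarrow> real) \<Rightarrow> bool" where
  "locally_stationary M x \<gamma> \<longleftrightarrow>
     (\<exists>K. \<forall>n. \<forall>i\<in>{1..n}. \<forall>j\<in>{1..n}.
        \<bar>covariance (M n) (x i n) (x j n) - \<gamma> (real i / real n) (nat \<bar>int i - int j\<bar>)\<bar>
          \<le> K * ((\<bar>real i - real j\<bar> + 1) / real n)) \<and>
     (\<exists>L. \<forall>k. L-lipschitz_on {0..1} (\<lambda>t. \<gamma> t k)) \<and>
     (\<forall>t\<in>{0..1}. stationary_autocovariance (\<gamma> t))"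

definition short_range_dependent ::
    "(nat \<Rightarrow> 'a measure) \<Rightarrow> (nat \<Rightarrow> nat \<Rightarrow> 'a \<Rightarrow> real) \<Rightarrow> real \<Rightarrow> bool" where
  "short_range_dependent M x \<tau> \<longleftrightarrow>
     (\<exists>C>0. \<forall>n. \<forall>k\<in>{1..n}. \<forall>r\<in>{- int k + 1..int n - int k}. r \<noteq> 0 \<longrightarrow>
        \<bar>covariance (M n) (x k n) (x (nat (int k + r)) n)\<bar> \<le> C * real_of_int \<bar>r\<bar> powr (- \<tau>)) \<and>
     (\<exists>B. \<forall>n. \<forall>i\<in>{1..n}. (\<integral>\<omega>. \<bar>x i n \<omega>\<bar> \<partial>M n) \<le> B)"

text \<open>Matrices are indexed from 0, hence the shift by one.\<close>

definition covariance_matrix ::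
    "(nat \<Rightarrow> 'a measure) \<Rightarrow> (nat \<Rightarrow> nat \<Rightarrow> 'a \<Rightarrow> real) \<Rightarrow> nat \<Rightarrow> real mat" where
  "covariance_matrix M x n =
     mat n n (\<lambda>(i, j). covariance (M n) (x (Suc i) n) (x (Suc j) n))"

text \<open>
  A real symmetric matrix of positive dimension has a nonempty finite real spectrum, so the
  minimum is attained.
\<close>

definition smallest_eigenvalue :: "real mat \<Rightarrow> real" where
  "smallest_eigenvalue A = Min (spectrum A)"

definition UPDC :: "(nat \<Rightarrow> 'a measure) \<Rightarrow> (nat \<Rightarrow> nat \<Rightarrow> 'a \<Rightarrow> real) \<Rightarrow> bool" where
  "UPDC M x \<longleftrightarrow>
     (\<exists>\<kappa>>0. \<forall>\<^sub>F n in sequentially. \<kappa> \<le> smallest_eigenvalue (covariance_matrix M x n))"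

definition spectral_density :: "(real \<Rightarrow> nat \<Rightarrow> real) \<Rightarrow> real \<Rightarrow> real \<Rightarrow> complex" where
  "spectral_density \<gamma> t \<omega> =
     (\<Sum>\<^sub>\<infinity>j\<in>(UNIV :: int set).
        complex_of_real (\<gamma> t (nat \<bar>j\<bar>)) * exp (- \<i> * of_int j * complex_of_real \<omega>))"

text \<open>
  The order on \<open>complex\<close> is that of \<open>HOL-Library.Complex_Order\<close>: \<open>z \<le> w\<close> means
  \<open>Re z \<le> Re w\<close> and \<open>Im z = Im w\<close>, so \<open>complex_of_real \<kappa> \<le> spectral_density \<gamma> t \<omega>\<close>
  says that the density is real and at least \<open>\<kappa>\<close>. For \<open>\<kappa> > 0\<close> it also excludes the default value 0 of a divergent sum.
\<close>

end

theory Submission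
  imports Defs
begin

text \<open>
  Cut a vector into all windows of a fixed length \<open>B\<close>. Each pair of indices at distance \<open>d\<close>
  lies in \<open>B - d\<close> windows, so \<open>B\<close> times the quadratic form of the covariance matrix is the sum of
  the forms of the windowed vectors up to a remainder which, by short-range dependence and
  Schur's test, is at most \<open>2 (\<Sum>k. min k B * w k)\<close> times the squared norm, where
  \<open>w k = C k powr (- \<tau>)\<close>. This is \<open>o(B)\<close>. Inside a window local
  stationarity replaces the covariances by the Toeplitz matrix of \<open>\<gamma> t\<close>, with an error that vanishes
  as \<open>n \<rightarrow> \<infinity>\<close> for fixed \<open>B\<close>, and the form of that matrix is at least the minimum of its symbol.

  Conversely, testing the covariance matrix on \<open>cos (i \<omega>)\<close> and \<open>sin (i \<omega>)\<close>, restricted to a window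
  around \<open>t n\<close>, bounds the Fejer means of the spectral density from below; they differ from the
  density by the same \<open>o(B)/B\<close>.
\<close>

subsection \<open>Cosine series and Toeplitz forms\<close>

text \<open>The detour through integers keeps the distance symmetric, which truncated subtraction
  would not, and is the form in which \<open>locally_stationary\<close> writes the lag.\<close>

definition lag :: "nat \<Rightarrow> nat \<Rightarrow> nat" where
  "lag i j = nat \<bar>int i - int j\<bar>"

lemma lag_commute: "lag i j = lag j i"
  by (simp add: lag_def abs_minus_commute)

lemma lag_eq_diff: "j \<le> i \<Longrightarrow> lag i j = i - j"
  by (simp add: lag_def nat_diff_distrib')

lemma lag_eq_0_iff [simp]: "lag i j = 0 \<longleftrightarrow> i = j"
  by (auto simp: lag_def)

lemma lag_self [simp]: "lag i i = 0"
  by simp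

lemma real_lag: "real (lag i j) = \<bar>real i - real j\<bar>"
  by (simp add: lag_def)

lemma lag_less: "i < n \<Longrightarrow> j < n \<Longrightarrow> lag i j < n"
  by (auto simp: lag_def)

lemma lag_add_left [simp]: "lag (p + i) (p + j) = lag i j"
  by (simp add: lag_def)

text \<open>Evenness of the cosine absorbs the absolute value. The separated variables on the right
  make the cosine kernel a sum of two rank-one kernels, so its form is a sum of two squares.\<close>

lemma cos_lag: "cos (real (lag i j) * \<omega>) = cos (real i * \<omega>) * cos (real j * \<omega>) + sin (real i * \<omega>) * sin (real j * \<omega>)"
proof -
  have "real (lag i j) * \<omega> = (real i - real j) * \<omega> \<or> real (lag i j) * \<omega> = - ((real i - real j) * \<omega>)"
    by (auto simp: real_lag abs_if algebra_simps)
  then have "cos (real (lag i j) * \<omega>) = cos ((real i - real j) * \<omega>)"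
    by (metis cos_minus)
  then show ?thesis
    by (simp add: left_diff_distrib cos_diff)
qed

text \<open>The number of integers of absolute value \<open>k\<close>.\<close>

definition lag_mult :: "nat \<Rightarrow> real" where
  "lag_mult k = (if k = 0 then 1 else 2)"

text \<open>The two-sided Fourier series of the even extension of \<open>h\<close>, with the lags
  \<open>k\<close> and \<open>-k\<close> paired.\<close>

definition cos_series :: "(nat \<Rightarrow> real) \<Rightarrow> real \<Rightarrow> real" where
  "cos_series h \<omega> = (\<Sum>k. lag_mult k * h k * cos (real k * \<omega>))"

lemma abs_cos_series_term_le: "\<bar>lag_mult k * h k * cos (real k * \<omega>)\<bar> \<le> 2 * \<bar>h k\<bar>"
proof -
  have "\<bar>lag_mult k\<bar> * \<bar>h k\<bar> * \<bar>cos (real k * \<omega>)\<bar> \<le> 2 * \<bar>h k\<bar> * 1"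
    by (intro mult_mono) (auto simp: lag_mult_def)
  then show ?thesis by (simp add: abs_mult)
qed

lemma summable_cos_series:
  assumes "summable (\<lambda>k. \<bar>h k\<bar>)"
  shows "summable (\<lambda>k. lag_mult k * h k * cos (real k * \<omega>))"
  by (rule summable_comparison_test'[OF summable_mult[OF assms, of 2]])
    (use abs_cos_series_term_le in auto)

text \<open>The cosines are real parts of the powers of an \<open>N\<close>-th root of unity. For
  \<open>0 < m < N\<close> this root is not 1, so its powers form a vanishing geometric sum.\<close>

lemma sum_cos_roots_of_unity:
  assumes "m < N"
  shows "(\<Sum>l<N. cos (real m * (2 * pi * real l / real N))) = (if m = 0 then real N else 0)"
proof (cases "m = 0")
  case False
  define z where "z = cis (2 * pi * real m / real N)"
  have "z \<noteq> 1"
  proof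
    assume "z = 1"
    then have "cos (2 * pi * real m / real N) = 1"
      by (metis z_def cis.simps(1) one_complex.simps(1))
    then obtain q :: int where "2 * pi * real m / real N = q * 2 * pi"
      by (auto simp: cos_one_2pi_int)
    then have "real m = q * real N"
      using assms by (simp add: field_simps)
    then have "int m = q * int N"
      by (metis of_int_eq_iff of_int_mult of_int_of_nat_eq)
    then have "int N dvd int m" by simp
    then show False using assms False by (auto dest: dvd_imp_le)
  qed
  moreover have "z ^ N = 1"
  proof -
    have "real N * (2 * pi * real m / real N) = 2 * pi * real m"
      using assms by simp
    then have "z ^ N = cis (2 * pi * real m)"
      by (simp only: z_def Complex.DeMoivre)
    then show ?thesis by simp
  qed
  ultimately have "(\<Sum>l<N. z ^ l) = 0"
    by (simp add: geometric_sum)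
  then have "(\<Sum>l<N. Re (z ^ l)) = 0"
    by (simp flip: Re_sum)
  moreover have "Re (z ^ l) = cos (real m * (2 * pi * real l / real N))" for l
    unfolding z_def Complex.DeMoivre by (simp add: mult_ac)
  ultimately show ?thesis using False by simp
qed simp

text \<open>Product-to-sum produces the frequencies \<open>lag k m\<close> and \<open>k + m\<close>,
  both below \<open>N\<close>. For \<open>k = m > 0\<close> only the first survives and gives
  \<open>N / 2\<close>; for \<open>k = m = 0\<close> both do. The factor \<open>lag_mult k\<close>
  evens this out.\<close>

lemma sum_cos_cos_roots_of_unity:
  assumes "k + m < N"
  shows "lag_mult k * (\<Sum>l<N. cos (real k * (2 * pi * real l / real N)) * cos (real m * (2 * pi * real l / real N)))
    = (if k = m then real N else 0)"
proof -
  let ?w = "\<lambda>l. 2 * pi * real l / real N"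
  have "cos (real k * \<theta>) * cos (real m * \<theta>) = (cos (real (lag k m) * \<theta>) + cos (real (k + m) * \<theta>)) / 2" for \<theta>
    by (simp add: cos_lag distrib_right cos_add)
  then have "(\<Sum>l<N. cos (real k * ?w l) * cos (real m * ?w l))
    = ((\<Sum>l<N. cos (real (lag k m) * ?w l)) + (\<Sum>l<N. cos (real (k + m) * ?w l))) / 2"
    by (simp only: sum.distrib sum_divide_distrib[symmetric])
  also have "\<dots> = ((if k = m then real N else 0) + (if k + m = 0 then real N else 0)) / 2"
    using assms lag_less[of k N m] by (simp only: sum_cos_roots_of_unity lag_eq_0_iff)
  finally show ?thesis by (auto simp: lag_mult_def)
qed

lemma sum_sum_cos_lag:
  "(\<Sum>i\<in>W. \<Sum>j\<in>W. a i * a j * cos (real (lag i j) * \<omega>))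
    = (\<Sum>i\<in>W. a i * cos (real i * \<omega>))\<^sup>2 + (\<Sum>i\<in>W. a i * sin (real i * \<omega>))\<^sup>2"
  by (simp only: cos_lag power2_eq_square sum_product distrib_left sum.distrib) (simp add: mult_ac)

lemma sum_rotate:
  "(\<Sum>l\<in>A. \<Sum>i\<in>B. \<Sum>j\<in>C. f l i j) = (\<Sum>i\<in>B. \<Sum>j\<in>C. \<Sum>l\<in>A. f l i j)"
  by (subst sum.swap, rule sum.cong[OF refl], rule sum.swap)

text \<open>Averaging over the \<open>N\<close>-th roots of unity recovers the coefficients of a trigonometric
  polynomial of degree below \<open>N\<close>, which replaces the Fourier integral of the symbol.\<close>

lemma toeplitz_form_ge:
  fixes a :: "nat \<Rightarrow> real"
  assumes summable: "summable (\<lambda>k. \<bar>h k\<bar>)"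
    and symbol: "\<And>\<omega>. \<kappa> \<le> cos_series h \<omega>"
    and W: "W \<subseteq> {..<B}"
  shows "\<kappa> * (\<Sum>i\<in>W. (a i)\<^sup>2) \<le> (\<Sum>i\<in>W. \<Sum>j\<in>W. h (lag i j) * a i * a j)" (is "_ * ?S \<le> ?Q")
proof -
  have fin: "finite W" using W finite_subset by blast
  \<comment> \<open>\<open>T J\<close> bounds the tail of the symbol uniformly in the frequency. The
    estimate is shown for the truncation \<open>P\<close> with \<open>\<kappa> - T J\<close> in
    place of \<open>\<kappa>\<close>; then \<open>J\<close> tends to infinity.\<close>
  define T where "T J = (\<Sum>k. 2 * \<bar>h (k + J)\<bar>)" for J
  have s2: "summable (\<lambda>k. 2 * \<bar>h k\<bar>)" by (rule summable_mult[OF summable])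
  have "T \<longlonglongrightarrow> 0"
    unfolding T_def by (rule suminf_exist_split2[OF s2])
  then have "(\<lambda>J. (\<kappa> - T J) * ?S) \<longlonglongrightarrow> (\<kappa> - 0) * ?S"
    by (intro tendsto_intros)
  moreover have "(\<kappa> - T J) * ?S \<le> ?Q" if "B \<le> J" for J
  proof -
    define P where "P \<omega> = (\<Sum>k<J. lag_mult k * h k * cos (real k * \<omega>))" for \<omega>
    \<comment> \<open>Large enough that \<open>k + lag i j < N\<close> for all \<open>k < J\<close>
      and all index pairs in \<open>W\<close>, so no aliasing occurs.\<close>
    define N where "N = J + B + 1"
    define w where "w l = 2 * pi * real l / real N" for l
    \<comment> \<open>The squared modulus of the Fourier transform of \<open>a\<close>. Over the
      nodes \<open>w l\<close> its mean is \<open>?S\<close>, and the mean of \<open>P\<close> times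
      it is \<open>?Q\<close>.\<close>
    define A where "A \<omega> = (\<Sum>i\<in>W. \<Sum>j\<in>W. a i * a j * cos (real (lag i j) * \<omega>))" for \<omega>
    have "A \<omega> \<ge> 0" for \<omega>
      unfolding A_def sum_sum_cos_lag by simp
    have P_ge: "\<kappa> - T J \<le> P \<omega>" for \<omega>
    proof -
      let ?u = "\<lambda>k. lag_mult k * h k * cos (real k * \<omega>)"
      have su: "summable ?u" by (rule summable_cos_series[OF summable])
      have "cos_series h \<omega> = (\<Sum>k. ?u (k + J)) + P \<omega>"
        unfolding cos_series_def P_def by (rule suminf_split_initial_segment[OF su])
      moreover have "(\<Sum>k. ?u (k + J)) \<le> T J"
        unfolding T_def
        using summable_ignore_initial_segment[OF su, of J] summable_ignore_initial_segment[OF s2, of J]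
        by (intro suminf_le order.trans[OF abs_ge_self abs_cos_series_term_le])
      ultimately show ?thesis using symbol[of \<omega>] by linarith
    qed
    have N: "N > 0" "real N > 0" by (auto simp: N_def)
    have lagN: "k + lag i j < N" if "i \<in> W" "j \<in> W" "k < J" for k i j
      using lag_less[of i B j] that W by (force simp: N_def)
    have lagN0: "lag i j < N" if "i \<in> W" "j \<in> W" for i j
      using lag_less[of i B j] that W by (force simp: N_def)
    have lagJ: "lag i j < J" if "i \<in> W" "j \<in> W" for i j
      using lag_less[of i B j] that W \<open>B \<le> J\<close> by force
    have "(\<Sum>l<N. A (w l)) = (\<Sum>i\<in>W. \<Sum>j\<in>W. a i * a j * (\<Sum>l<N. cos (real (lag i j) * w l)))"
      unfolding A_def sum_distrib_left by (rule sum_rotate)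
    also have "\<dots> = (\<Sum>i\<in>W. \<Sum>j\<in>W. if i = j then real N * (a i * a i) else 0)"
    proof (intro sum.cong[OF refl])
      fix i j assume "i \<in> W" "j \<in> W"
      then have "(\<Sum>l<N. cos (real (lag i j) * w l)) = (if i = j then real N else 0)"
        unfolding w_def by (subst sum_cos_roots_of_unity) (auto intro: lagN0)
      then show "a i * a j * (\<Sum>l<N. cos (real (lag i j) * w l)) = (if i = j then real N * (a i * a i) else 0)"
        by (simp only:) simp
    qed
    also have "\<dots> = real N * ?S"
      using fin by (simp add: sum_distrib_left power2_eq_square)
    finally have S: "(\<Sum>l<N. A (w l)) = real N * ?S" .
    have "P (w l) * A (w l) = (\<Sum>i\<in>W. \<Sum>j\<in>W. \<Sum>k<J. a i * a j * h k * (lag_mult k * (cos (real k * w l) * cos (real (lag i j) * w l))))" for l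
    proof -
      have "P (w l) * (a i * a j * cos (real (lag i j) * w l))
        = (\<Sum>k<J. a i * a j * h k * (lag_mult k * (cos (real k * w l) * cos (real (lag i j) * w l))))" for i j
        unfolding P_def sum_distrib_right by (intro sum.cong refl) (simp only: mult_ac)
      then show ?thesis by (simp only: A_def sum_distrib_left)
    qed
    then have "(\<Sum>l<N. P (w l) * A (w l)) = (\<Sum>i\<in>W. \<Sum>j\<in>W. \<Sum>l<N. \<Sum>k<J. a i * a j * h k * (lag_mult k * (cos (real k * w l) * cos (real (lag i j) * w l))))"
      by (simp only:) (rule sum_rotate)
    also have "\<dots> = (\<Sum>i\<in>W. \<Sum>j\<in>W. \<Sum>k<J. if k = lag i j then real N * (h (lag i j) * a i * a j) else 0)"
    proof (intro sum.cong[OF refl])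
      fix i j assume "i \<in> W" "j \<in> W"
      have "(\<Sum>l<N. \<Sum>k<J. a i * a j * h k * (lag_mult k * (cos (real k * w l) * cos (real (lag i j) * w l))))
        = (\<Sum>k<J. a i * a j * h k * (lag_mult k * (\<Sum>l<N. cos (real k * w l) * cos (real (lag i j) * w l))))"
        unfolding sum_distrib_left by (rule sum.swap)
      also have "\<dots> = (\<Sum>k<J. if k = lag i j then real N * (h (lag i j) * a i * a j) else 0)"
      proof (intro sum.cong[OF refl])
        fix k assume "k \<in> {..<J}"
        then have "lag_mult k * (\<Sum>l<N. cos (real k * w l) * cos (real (lag i j) * w l)) = (if k = lag i j then real N else 0)"
          unfolding w_def using \<open>i \<in> W\<close> \<open>j \<in> W\<close> by (intro sum_cos_cos_roots_of_unity lagN) auto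
        then show "a i * a j * h k * (lag_mult k * (\<Sum>l<N. cos (real k * w l) * cos (real (lag i j) * w l)))
          = (if k = lag i j then real N * (h (lag i j) * a i * a j) else 0)"
          by (simp only:) simp
      qed
      finally show "(\<Sum>l<N. \<Sum>k<J. a i * a j * h k * (lag_mult k * (cos (real k * w l) * cos (real (lag i j) * w l))))
        = (\<Sum>k<J. if k = lag i j then real N * (h (lag i j) * a i * a j) else 0)" .
    qed
    also have "\<dots> = real N * ?Q"
      by (simp add: sum_distrib_left lagJ)
    finally have Q: "(\<Sum>l<N. P (w l) * A (w l)) = real N * ?Q" .
    have "real N * ((\<kappa> - T J) * ?S) = (\<Sum>l<N. (\<kappa> - T J) * A (w l))"
      by (simp add: S flip: sum_distrib_left)
    also have "\<dots> \<le> (\<Sum>l<N. P (w l) * A (w l))"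
      by (intro sum_mono mult_right_mono P_ge \<open>\<And>\<omega>. A \<omega> \<ge> 0\<close>)
    finally show ?thesis using N unfolding Q by (simp only: mult_le_cancel_left_pos)
  qed
  ultimately show ?thesis
    by (intro LIMSEQ_le_const2[where X = "\<lambda>J. (\<kappa> - T J) * ?S"]) auto
qed

subsection \<open>Sums over index pairs\<close>

text \<open>For \<open>0 < k < B\<close> there are two diagonals at distance \<open>k\<close>, each
  with \<open>B - k\<close> entries. The induction appends a row and a column, which contribute lag
  0 once and each lag from 1 to \<open>B\<close> twice. With cosine-weighted \<open>\<phi>\<close>
  the sum is \<open>B\<close> times a Fejer mean.\<close>

lemma sum_sum_lag:
  fixes \<phi> :: "nat \<Rightarrow> real"
  shows "(\<Sum>i<B. \<Sum>j<B. \<phi> (lag i j)) = (\<Sum>k<B. lag_mult k * (real B - real k) * \<phi> k)"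
proof (induction B)
  case (Suc B)
  have r: "(\<Sum>j<B. \<phi> (lag B j)) = (\<Sum>k<B. \<phi> (Suc k))"
  proof -
    have "(\<Sum>j<B. \<phi> (lag B j)) = (\<Sum>j<B. \<phi> (Suc (B - Suc j)))"
      by (intro sum.cong refl) (auto simp: lag_eq_diff Suc_diff_Suc)
    also have "\<dots> = (\<Sum>k<B. \<phi> (Suc k))" by (rule sum.nat_diff_reindex)
    finally show ?thesis .
  qed
  have r': "(\<Sum>i<B. \<phi> (lag i B)) = (\<Sum>k<B. \<phi> (Suc k))"
    unfolding r[symmetric] by (subst lag_commute) (rule refl)
  have "(\<Sum>i<Suc B. \<Sum>j<Suc B. \<phi> (lag i j))
    = (\<Sum>i<B. \<Sum>j<B. \<phi> (lag i j)) + (\<phi> 0 + 2 * (\<Sum>k<B. \<phi> (Suc k)))"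
    by (simp add: sum.distrib r r')
  also have "\<phi> 0 + 2 * (\<Sum>k<B. \<phi> (Suc k)) = (\<Sum>k<Suc B. lag_mult k * \<phi> k)"
    by (simp only: sum.lessThan_Suc_shift) (simp add: lag_mult_def sum_distrib_left)
  \<comment> \<open>The added term \<open>k = B\<close> carries the factor
    \<open>real B - real k = 0\<close>.\<close>
  also have "(\<Sum>i<B. \<Sum>j<B. \<phi> (lag i j)) = (\<Sum>k<Suc B. lag_mult k * (real B - real k) * \<phi> k)"
    using Suc.IH by simp
  finally show ?case
    by (simp only: sum.distrib[symmetric]) (simp add: algebra_simps)
qed simp

text \<open>On either side of \<open>i\<close> the map \<open>lag i\<close> is injective, so each
  lag occurs at most twice.\<close>

lemma sum_lag_le:
  fixes u :: "nat \<Rightarrow> real"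
  assumes "\<And>k. 0 \<le> u k" "i < n"
  shows "(\<Sum>j<n. u (lag i j)) \<le> 2 * (\<Sum>k<n. u k)"
proof -
  have half: "(\<Sum>j\<in>A. u (lag i j)) \<le> (\<Sum>k<n. u k)" if "inj_on (lag i) A" "A \<subseteq> {..<n}" for A
  proof -
    have "(\<Sum>j\<in>A. u (lag i j)) = (\<Sum>k\<in>lag i ` A. u k)"
      using that by (simp add: sum.reindex)
    also have "\<dots> \<le> (\<Sum>k<n. u k)"
      using assms that by (intro sum_mono2) (auto intro!: lag_less)
    finally show ?thesis .
  qed
  have split: "{..<n} = {..i} \<union> {i<..<n}" using assms by auto
  have "(\<Sum>j<n. u (lag i j)) = (\<Sum>j\<in>{..i}. u (lag i j)) + (\<Sum>j\<in>{i<..<n}. u (lag i j))"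
    unfolding split by (intro sum.union_disjoint) auto
  also have "\<dots> \<le> (\<Sum>k<n. u k) + (\<Sum>k<n. u k)"
  proof (intro add_mono half)
    show "inj_on (lag i) {..i}" "inj_on (lag i) {i<..<n}"
      by (auto simp: inj_on_def lag_def)
  qed (use assms in auto)
  finally show ?thesis by simp
qed

text \<open>Schur's test: the arithmetic-geometric mean inequality separates \<open>a i\<close> from
  \<open>a j\<close>, and symmetry of \<open>u\<close> turns both halves into the same weighted row
  sums.\<close>

lemma sum_sum_mult_le:
  fixes a :: "nat \<Rightarrow> real"
  assumes sym: "\<And>i j. u i j = u j i" and nonneg: "\<And>i j. 0 \<le> u i j"
    and row: "\<And>i. i \<in> W \<Longrightarrow> (\<Sum>j\<in>W. u i j) \<le> R"
  shows "(\<Sum>i\<in>W. \<Sum>j\<in>W. u i j * \<bar>a i * a j\<bar>) \<le> R * (\<Sum>i\<in>W. (a i)\<^sup>2)"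
proof -
  have am: "\<bar>a i * a j\<bar> \<le> ((a i)\<^sup>2 + (a j)\<^sup>2) / 2" for i j
    using sum_squares_bound[of "\<bar>a i\<bar>" "\<bar>a j\<bar>"] by (simp add: abs_mult)
  have "(\<Sum>i\<in>W. \<Sum>j\<in>W. u i j * \<bar>a i * a j\<bar>) \<le> (\<Sum>i\<in>W. \<Sum>j\<in>W. u i j * (((a i)\<^sup>2 + (a j)\<^sup>2) / 2))"
    by (intro sum_mono mult_left_mono am nonneg)
  also have "\<dots> = ((\<Sum>i\<in>W. \<Sum>j\<in>W. u i j * (a i)\<^sup>2) + (\<Sum>i\<in>W. \<Sum>j\<in>W. u i j * (a j)\<^sup>2)) / 2"
    by (simp add: distrib_left add_divide_distrib sum.distrib flip: sum_divide_distrib)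
  also have "(\<Sum>i\<in>W. \<Sum>j\<in>W. u i j * (a j)\<^sup>2) = (\<Sum>i\<in>W. \<Sum>j\<in>W. u i j * (a i)\<^sup>2)"
    by (subst sum.swap) (simp add: sym)
  also have "(\<Sum>i\<in>W. \<Sum>j\<in>W. u i j * (a i)\<^sup>2) = (\<Sum>i\<in>W. (\<Sum>j\<in>W. u i j) * (a i)\<^sup>2)"
    by (simp add: sum_distrib_right)
  also have "\<dots> \<le> (\<Sum>i\<in>W. R * (a i)\<^sup>2)"
    by (intro sum_mono mult_right_mono row) auto
  finally show ?thesis by (simp add: sum_distrib_left[symmetric])
qed

section \<open>Summable weights truncated at the window length\<close>

lemma summable_min_mult:
  fixes w :: "nat \<Rightarrow> real"
  assumes "summable w" "\<And>k. 0 \<le> w k"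
  shows "summable (\<lambda>k. min (real k) (real B) * w k)"
proof (rule summable_comparison_test'[OF summable_mult[OF assms(1), of "real B"]])
  show "norm (min (real k) (real B) * w k) \<le> real B * w k" for k
    using mult_right_mono[OF min.cobounded2 assms(2), of "real k" "real B" k] assms(2)[of k]
    by simp
qed

text \<open>The sum is \<open>o(B)\<close>. Lags from \<open>J\<close> on contribute at most
  \<open>B\<close> times a small tail; those below \<open>J\<close> contribute at most a constant,
  which a large \<open>B\<close> absorbs. Each part receives half of
  \<open>\<epsilon>\<close>.\<close>

lemma ex_suminf_min_le:
  fixes w :: "nat \<Rightarrow> real"
  assumes w: "summable w" "\<And>k. 0 \<le> w k" and "\<epsilon> > 0"
  shows "\<exists>B>0. (\<Sum>k. min (real k) (real B) * w k) \<le> \<epsilon> * real B"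
proof -
  have "(\<lambda>J. \<Sum>k. w (k + J)) \<longlonglongrightarrow> 0"
    by (rule suminf_exist_split2[OF w(1)])
  then have "eventually (\<lambda>J. (\<Sum>k. w (k + J)) < \<epsilon> / 2) sequentially"
    by (rule order_tendstoD) (use \<open>\<epsilon> > 0\<close> in simp)
  then obtain J where J: "(\<Sum>k. w (k + J)) < \<epsilon> / 2"
    by (auto simp: eventually_sequentially)
  obtain B0 :: nat where B0: "(\<Sum>k<J. real k * w k) / (\<epsilon> / 2) < real B0"
    using reals_Archimedean2 by blast
  define B where "B = Suc B0"
  have "(\<Sum>k<J. real k * w k) \<le> real B0 * (\<epsilon> / 2)"
    using B0 \<open>\<epsilon> > 0\<close> by (simp add: field_simps)
  also have "\<dots> \<le> real B * (\<epsilon> / 2)"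
    using \<open>\<epsilon> > 0\<close> by (intro mult_right_mono) (auto simp: B_def)
  finally have B: "(\<Sum>k<J. real k * w k) \<le> real B * (\<epsilon> / 2)" .
  let ?u = "\<lambda>k. min (real k) (real B) * w k"
  have su: "summable ?u" by (rule summable_min_mult[OF w])
  have "(\<Sum>k. ?u k) = (\<Sum>k. ?u (k + J)) + (\<Sum>k<J. ?u k)"
    by (rule suminf_split_initial_segment[OF su])
  also have "(\<Sum>k<J. ?u k) \<le> (\<Sum>k<J. real k * w k)"
    by (intro sum_mono mult_right_mono w) auto
  also note B
  also have "(\<Sum>k. ?u (k + J)) \<le> (\<Sum>k. real B * w (k + J))"
    using summable_ignore_initial_segment[OF su, of J]
      summable_mult[OF summable_ignore_initial_segment[OF w(1), of J], of "real B"]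
    by (intro suminf_le mult_right_mono w) auto
  also have "\<dots> = real B * (\<Sum>k. w (k + J))"
    by (rule suminf_mult) (use w(1) in \<open>simp add: summable_iff_shift\<close>)
  also have "\<dots> \<le> real B * (\<epsilon> / 2)"
    using J by (intro mult_left_mono) auto
  finally have "(\<Sum>k. ?u k) \<le> \<epsilon> * real B" by simp
  then show ?thesis by (intro exI[of _ B]) (simp add: B_def)
qed

text \<open>Absolute summability permits splitting the unordered sum into nonnegative and negative
  indices. Pairing \<open>j\<close> with \<open>-j\<close> cancels the sines, so the density is
  real, as the order on complex numbers demands.\<close>

lemma spectral_density_eq_cos_series:
  assumes "summable (\<lambda>k. \<bar>\<gamma> t k\<bar>)"
  shows "spectral_density \<gamma> t \<omega> = complex_of_real (cos_series (\<gamma> t) \<omega>)"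
proof -
  define c where "c j = complex_of_real (\<gamma> t (nat \<bar>j\<bar>)) * exp (- \<i> * of_int j * complex_of_real \<omega>)" for j :: int
  have c_cis: "c j = complex_of_real (\<gamma> t (nat \<bar>j\<bar>)) * cis (- (of_int j * \<omega>))" for j
    by (simp add: c_def cis_conv_exp mult_ac)
  define f where "f n = c (int n)" for n
  define g where "g n = c (- int (Suc n))" for n
  have norm_f: "norm (f n) = \<bar>\<gamma> t n\<bar>" for n
    by (simp add: f_def c_cis norm_mult)
  have norm_g: "norm (g n) = \<bar>\<gamma> t (Suc n)\<bar>" for n
    by (simp add: g_def c_cis norm_mult nat_add_distrib)
  have nf: "summable (\<lambda>n. norm (f n))"
    using assms by (simp only: norm_f)
  have ng: "summable (\<lambda>n. norm (g n))"
    unfolding norm_g by (rule summable_Suc_iff[THEN iffD2, OF assms])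
  obtain X where X: "f sums X"
    using summable_norm_cancel[OF nf] by (auto simp: summable_def)
  obtain Y where Y: "g sums Y"
    using summable_norm_cancel[OF ng] by (auto simp: summable_def)
  have "(c has_sum X) (range int)"
    by (subst has_sum_reindex) (use norm_summable_imp_has_sum[OF nf X] in \<open>simp_all add: f_def[abs_def] o_def\<close>)
  moreover have "(c has_sum Y) (range (\<lambda>n. - int (Suc n)))"
    by (subst has_sum_reindex) (use norm_summable_imp_has_sum[OF ng Y] in \<open>simp_all add: g_def[abs_def] o_def inj_on_def\<close>)
  ultimately have "(c has_sum (X + Y)) (range int \<union> range (\<lambda>n. - int (Suc n)))"
    by (rule has_sum_Un_disjoint) auto
  moreover have "range int \<union> range (\<lambda>n. - int (Suc n)) = UNIV"
  proof -
    have "j \<in> range int \<union> range (\<lambda>n. - int (Suc n))" for j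
      by (cases j rule: int_cases) (auto intro: rev_image_eqI)
    then show ?thesis by blast
  qed
  ultimately have "(c has_sum (X + Y)) UNIV" by simp
  then have "spectral_density \<gamma> t \<omega> = X + Y"
    unfolding spectral_density_def c_def[symmetric] by (rule infsumI)
  moreover have "(\<lambda>n. complex_of_real (lag_mult n * \<gamma> t n * cos (real n * \<omega>))) sums (X + Y)"
  proof -
    \<comment> \<open>The leading 0 aligns the two series: \<open>g\<close> starts at index -1, and
      lag 0 has no negative partner.\<close>
    define g' where "g' n = (case n of 0 \<Rightarrow> 0 | Suc m \<Rightarrow> g m)" for n
    have "g' sums Y"
      using sums_Suc[of g' Y] Y by (simp add: g'_def)
    then have "(\<lambda>n. f n + g' n) sums (X + Y)"
      using X by (rule sums_add[rotated])
    moreover have "f n + g' n = complex_of_real (lag_mult n * \<gamma> t n * cos (real n * \<omega>))" for n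
    proof (cases n)
      case 0
      then show ?thesis by (simp add: f_def g'_def c_cis lag_mult_def)
    next
      case (Suc m)
      have "nat \<bar>- int (Suc m)\<bar> = Suc m" by simp
      then have "g m = complex_of_real (\<gamma> t n) * cis (real n * \<omega>)"
        unfolding g_def c_cis Suc by (simp del: of_nat_Suc)
      moreover have "f n = complex_of_real (\<gamma> t n) * cis (- (real n * \<omega>))"
        by (simp add: f_def c_cis)
      ultimately show ?thesis
        by (simp add: Suc g'_def lag_mult_def complex_eq_iff del: of_nat_Suc)
    qed
    ultimately show ?thesis by simp
  qed
  then have "X + Y = complex_of_real (cos_series (\<gamma> t) \<omega>)"
    using sums_of_real[OF summable_sums[OF summable_cos_series[OF assms, of \<omega>]], where 'a = complex]
    unfolding cos_series_def by (rule sums_unique2)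
  ultimately show ?thesis by simp
qed

subsection \<open>The smallest eigenvalue as a minimal Rayleigh quotient\<close>

text \<open>Vectors of length \<open>n\<close> are represented by functions on all naturals, hence
  the coordinates from \<open>n\<close> on are pinned to 0. Tychonoff makes the box compact. The
  sphere is closed because it constrains finitely many coordinates.\<close>

lemma compact_box_sphere:
  "compact {v :: nat \<Rightarrow> real. (\<forall>i. v i \<in> (if i < n then {-1..1} else {0})) \<and> (\<Sum>i<n. (v i)\<^sup>2) = 1}"
proof -
  let ?T = "\<lambda>i. if i < n then {-1..1} else {0 :: real}"
  have "compactin (product_topology (\<lambda>_. euclidean) UNIV) (Pi\<^sub>E UNIV ?T)"
    by (simp add: compactin_PiE)
  then have "compact (Pi\<^sub>E UNIV ?T)"
    by (simp add: euclidean_product_topology)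
  moreover have "closed {v :: nat \<Rightarrow> real. (\<Sum>i<n. (v i)\<^sup>2) = 1}"
    by (intro closed_Collect_eq continuous_intros continuous_on_product_coordinates)
  ultimately have "compact (Pi\<^sub>E UNIV ?T \<inter> {v. (\<Sum>i<n. (v i)\<^sup>2) = 1})"
    by (rule compact_Int_closed)
  moreover have "Pi\<^sub>E UNIV ?T \<inter> {v. (\<Sum>i<n. (v i)\<^sup>2) = 1}
    = {v. (\<forall>i. v i \<in> ?T i) \<and> (\<Sum>i<n. (v i)\<^sup>2) = 1}"
    by (auto simp: PiE_def Pi_def)
  ultimately show ?thesis by simp
qed

definition quad_form :: "(nat \<Rightarrow> nat \<Rightarrow> real) \<Rightarrow> nat set \<Rightarrow> (nat \<Rightarrow> real) \<Rightarrow> real" where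
  "quad_form A W v = (\<Sum>i\<in>W. \<Sum>j\<in>W. A i j * v i * v j)"

text \<open>The continuous form attains its minimum on the compact unit sphere, and homogeneity of
  degree 2 carries the bound to all vectors.\<close>

lemma ex_quadratic_form_minimizer:
  fixes A :: "nat \<Rightarrow> nat \<Rightarrow> real" and n :: nat
  defines "Q \<equiv> quad_form A {..<n}"
  assumes "n > 0"
  shows "\<exists>u. (\<Sum>i<n. (u i)\<^sup>2) = 1 \<and> (\<forall>v. Q u * (\<Sum>i<n. (v i)\<^sup>2) \<le> Q v)"
proof -
  let ?S = "{v :: nat \<Rightarrow> real. (\<forall>i. v i \<in> (if i < n then {-1..1} else {0})) \<and> (\<Sum>i<n. (v i)\<^sup>2) = 1}"
  have "(\<lambda>i. if i = 0 then 1 else 0) \<in> ?S"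
    using \<open>n > 0\<close> by (auto simp: if_distrib[of "\<lambda>x. x\<^sup>2"] cong: if_cong)
  then have ne: "?S \<noteq> {}" by (metis (no_types, lifting) empty_iff)
  have cont: "continuous_on ?S Q"
    unfolding Q_def quad_form_def
    by (intro continuous_intros continuous_on_subset[OF continuous_on_product_coordinates]) auto
  obtain u where u: "u \<in> ?S" and u_le: "\<forall>v\<in>?S. Q u \<le> Q v"
    using continuous_attains_inf[OF compact_box_sphere ne cont] by (rule bexE)
  have "Q u * (\<Sum>i<n. (v i)\<^sup>2) \<le> Q v" for v
  proof (cases "(\<Sum>i<n. (v i)\<^sup>2) = 0")
    case True
    then have "v i = 0" if "i < n" for i
      using that by (simp add: sum_nonneg_eq_0_iff)
    then have "Q v = 0" by (simp add: Q_def quad_form_def)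
    with True show ?thesis by simp
  next
    case False
    define r where "r = (\<Sum>i<n. (v i)\<^sup>2)"
    have "r > 0"
      using False sum_nonneg[of "{..<n}" "\<lambda>i. (v i)\<^sup>2"] unfolding r_def by simp
    define v' where "v' i = (if i < n then v i / sqrt r else 0)" for i
    have "(v i)\<^sup>2 \<le> r" if "i < n" for i
      unfolding r_def by (rule member_le_sum) (use that in auto)
    then have "\<bar>v i\<bar> \<le> sqrt r" if "i < n" for i
      using that real_le_rsqrt[of "\<bar>v i\<bar>" r] by simp
    then have "\<bar>v' i\<bar> \<le> 1" if "i < n" for i
      using that \<open>r > 0\<close> by (simp add: v'_def)
    moreover have "(\<Sum>i<n. (v' i)\<^sup>2) = 1"
      using \<open>r > 0\<close> by (simp add: v'_def power_divide r_def[symmetric] flip: sum_divide_distrib)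
    moreover have "v' i = 0" if "\<not> i < n" for i
      using that by (simp add: v'_def)
    ultimately have "v' \<in> ?S"
      by (simp add: abs_le_iff minus_le_iff)
    with u_le have "Q u \<le> Q v'" by (rule bspec)
    also have "Q v' = (\<Sum>i<n. \<Sum>j<n. A i j * v i * v j / r)"
      unfolding Q_def quad_form_def
    proof (intro sum.cong[OF refl])
      fix i j assume "i \<in> {..<n}" "j \<in> {..<n}"
      then have "A i j * v' i * v' j = A i j * v i * v j / (sqrt r * sqrt r)"
        by (simp add: v'_def)
      also have "sqrt r * sqrt r = r" using \<open>r > 0\<close> by simp
      finally show "A i j * v' i * v' j = A i j * v i * v j / r" .
    qed
    also have "\<dots> = Q v / r"
      by (simp add: Q_def quad_form_def sum_divide_distrib)
    finally show ?thesis
      using \<open>r > 0\<close> by (simp add: r_def[symmetric] field_simps)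
  qed
  moreover have "(\<Sum>i<n. (u i)\<^sup>2) = 1" using u by simp
  ultimately show ?thesis by blast
qed

text \<open>First variation in the direction of the residual \<open>w\<close> of the eigenvalue
  equation: moving \<open>u\<close> by \<open>\<epsilon> * w\<close> changes the slack in
  \<open>min\<close> to \<open>2 * \<epsilon> * W + \<epsilon>\<^sup>2 * c\<close>. This is
  nonnegative for every \<open>\<epsilon>\<close> only if the squared norm \<open>W\<close> of
  \<open>w\<close> is 0.\<close>

lemma quadratic_form_minimizer_eigenvector:
  fixes A :: "nat \<Rightarrow> nat \<Rightarrow> real" and n :: nat
  defines "Q \<equiv> quad_form A {..<n}"
  assumes sym: "\<And>i j. A i j = A j i"
    and unit: "(\<Sum>i<n. (u i)\<^sup>2) = 1"
    and min: "\<And>v. Q u * (\<Sum>i<n. (v i)\<^sup>2) \<le> Q v"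
    and "i < n"
  shows "(\<Sum>j<n. A i j * u j) = Q u * u i"
proof -
  define w where "w i = (\<Sum>j<n. A i j * u j) - Q u * u i" for i
  define W where "W = (\<Sum>i<n. (w i)\<^sup>2)"
  define c where "c = Q w - Q u * W"
  have cross: "(\<Sum>i<n. \<Sum>j<n. A i j * w i * u j) - Q u * (\<Sum>i<n. u i * w i) = W"
  proof -
    have "W = (\<Sum>i<n. w i * (\<Sum>j<n. A i j * u j) - Q u * (u i * w i))"
      unfolding W_def by (intro sum.cong refl) (simp add: w_def power2_eq_square algebra_simps)
    also have "\<dots> = (\<Sum>i<n. w i * (\<Sum>j<n. A i j * u j)) - Q u * (\<Sum>i<n. u i * w i)"
      by (simp only: sum_subtractf sum_distrib_left)
    also have "(\<Sum>i<n. w i * (\<Sum>j<n. A i j * u j)) = (\<Sum>i<n. \<Sum>j<n. A i j * w i * u j)"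
      by (simp add: sum_distrib_left mult_ac)
    finally show ?thesis by simp
  qed
  then have cross': "(\<Sum>i<n. \<Sum>j<n. A i j * w i * u j) = W + Q u * (\<Sum>i<n. u i * w i)"
    by simp
  have swap: "(\<Sum>i<n. \<Sum>j<n. A i j * u i * w j) = (\<Sum>i<n. \<Sum>j<n. A i j * w i * u j)"
    by (subst sum.swap) (intro sum.cong refl, simp add: sym mult_ac)
  have "0 \<le> 2 * \<epsilon> * W + \<epsilon>\<^sup>2 * c" for \<epsilon>
  proof -
    have Q_expand: "Q (\<lambda>i. u i + \<epsilon> * w i) = Q u + \<epsilon> * (\<Sum>i<n. \<Sum>j<n. A i j * u i * w j)
      + \<epsilon> * (\<Sum>i<n. \<Sum>j<n. A i j * w i * u j) + \<epsilon>\<^sup>2 * Q w"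
      unfolding Q_def quad_form_def sum_distrib_left sum.distrib[symmetric]
      by (intro sum.cong refl) (simp add: algebra_simps power2_eq_square)
    have norm_expand: "(\<Sum>i<n. (u i + \<epsilon> * w i)\<^sup>2) = 1 + 2 * \<epsilon> * (\<Sum>i<n. u i * w i) + \<epsilon>\<^sup>2 * W"
      unfolding unit[symmetric] W_def sum_distrib_left sum.distrib[symmetric]
      by (intro sum.cong refl) (simp add: algebra_simps power2_eq_square)
    show ?thesis
      using min[of "\<lambda>i. u i + \<epsilon> * w i"]
      unfolding Q_expand norm_expand swap cross' c_def by (simp add: algebra_simps)
  qed
  \<comment> \<open>With this negative step the quadratic term is at most half the linear one in
    size; the \<open>+ 1\<close> keeps the denominator positive.\<close>
  from this[of "- W / (\<bar>c\<bar> + 1)"] have "2 * (W / (\<bar>c\<bar> + 1)) * W \<le> (W / (\<bar>c\<bar> + 1))\<^sup>2 * c"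
    by (simp add: power2_eq_square)
  also have "\<dots> \<le> (W / (\<bar>c\<bar> + 1))\<^sup>2 * (\<bar>c\<bar> + 1)"
    by (intro mult_left_mono) auto
  also have "\<dots> = W / (\<bar>c\<bar> + 1) * W"
    by (simp add: power2_eq_square)
  finally have "W\<^sup>2 / (\<bar>c\<bar> + 1) \<le> 0"
    by (simp add: power2_eq_square)
  then have "W = 0"
    by (simp add: divide_le_0_iff) (smt (verit) zero_less_power2)
  then have "w i = 0"
    using \<open>i < n\<close> by (simp add: W_def sum_nonneg_eq_0_iff)
  then show ?thesis by (simp add: w_def)
qed

text \<open>The minimizer of the Rayleigh quotient is an eigenvector, so its value lies in the
  spectrum and dominates \<open>Min\<close>. Conversely, evaluating the form at an eigenvector
  bounds each eigenvalue. No diagonalization is involved.\<close>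

lemma smallest_eigenvalue_ge_iff:
  fixes A :: "nat \<Rightarrow> nat \<Rightarrow> real" and n :: nat
  assumes "n > 0" and sym: "\<And>i j. A i j = A j i"
  shows "c \<le> smallest_eigenvalue (mat n n (\<lambda>(i, j). A i j)) \<longleftrightarrow>
    (\<forall>v. c * (\<Sum>i<n. (v i)\<^sup>2) \<le> quad_form A {..<n} v)"
proof -
  let ?M = "mat n n (\<lambda>(i, j). A i j)"
  define Q where "Q = quad_form A {..<n}"
  obtain u where u: "(\<Sum>i<n. (u i)\<^sup>2) = 1" "\<And>v. Q u * (\<Sum>i<n. (v i)\<^sup>2) \<le> Q v"
    using ex_quadratic_form_minimizer[OF \<open>n > 0\<close>, of A] unfolding Q_def by blast
  have ev: "(\<Sum>j<n. A i j * u j) = Q u * u i" if "i < n" for i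
    unfolding Q_def
    by (rule quadratic_form_minimizer_eigenvector[OF sym u(1) u(2)[unfolded Q_def] that])
  have mult: "vec_index (?M *\<^sub>v v) i = (\<Sum>j<n. A i j * vec_index v j)" if "v \<in> carrier_vec n" "i < n" for v i
    using that by (simp add: scalar_prod_def lessThan_atLeast0)
  have "vec n u \<noteq> 0\<^sub>v n"
  proof
    assume "vec n u = 0\<^sub>v n"
    then have "u i = 0" if "i < n" for i
      using that by (metis index_vec index_zero_vec(1))
    with u(1) show False by simp
  qed
  moreover have "?M *\<^sub>v vec n u = Q u \<cdot>\<^sub>v vec n u"
  proof (rule eq_vecI)
    fix i assume "i < dim_vec (Q u \<cdot>\<^sub>v vec n u)"
    then show "vec_index (?M *\<^sub>v vec n u) i = vec_index (Q u \<cdot>\<^sub>v vec n u) i"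
      using ev[of i] mult[of "vec n u" i] by simp
  qed simp
  ultimately have mem: "Q u \<in> spectrum ?M"
    unfolding spectrum_def eigenvalue_def eigenvector_def
    by (auto intro!: exI[of _ "Matrix.vec n u"])
  have fin: "finite (spectrum ?M)"
    by (rule card_finite_spectrum[of _ n]) simp
  have le: "c \<le> k" if "k \<in> spectrum ?M" and form: "\<And>v. c * (\<Sum>i<n. (v i)\<^sup>2) \<le> Q v" for k
  proof -
    obtain v where v: "v \<in> carrier_vec n" "v \<noteq> 0\<^sub>v n" "?M *\<^sub>v v = k \<cdot>\<^sub>v v"
      using \<open>k \<in> spectrum ?M\<close> unfolding spectrum_def eigenvalue_def eigenvector_def by auto
    have "(\<Sum>j<n. A i j * vec_index v j) = k * vec_index v i" if "i < n" for i
      using mult[OF v(1) that] v that by simp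
    then have "(\<Sum>i<n. vec_index v i * (\<Sum>j<n. A i j * vec_index v j)) = (\<Sum>i<n. vec_index v i * (k * vec_index v i))"
      by (intro sum.cong) auto
    then have "Q (vec_index v) = k * (\<Sum>i<n. (vec_index v i)\<^sup>2)"
      by (simp add: Q_def quad_form_def sum_distrib_left power2_eq_square mult_ac)
    moreover have "(\<Sum>i<n. (vec_index v i)\<^sup>2) > 0"
    proof -
      obtain i where "i < n" "vec_index v i \<noteq> 0"
        using v(1,2) by (metis carrier_vecD eq_vecI index_zero_vec)
      then show ?thesis by (intro sum_pos2[of _ i]) auto
    qed
    ultimately show ?thesis
      using form[of "vec_index v"] by simp
  qed
  have "c * (\<Sum>i<n. (v i)\<^sup>2) \<le> Q v" if "c \<le> Min (spectrum ?M)" for v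
  proof -
    have "c \<le> Q u"
      using that Min_le[OF fin mem] by linarith
    then have "c * (\<Sum>i<n. (v i)\<^sup>2) \<le> Q u * (\<Sum>i<n. (v i)\<^sup>2)"
      by (intro mult_right_mono sum_nonneg) auto
    then show ?thesis using u(2)[of v] by linarith
  qed
  moreover have "c \<le> Min (spectrum ?M)" if "\<forall>v. c * (\<Sum>i<n. (v i)\<^sup>2) \<le> Q v"
    using that fin mem le by (subst Min_ge_iff) auto
  ultimately show ?thesis
    unfolding smallest_eigenvalue_def Q_def[symmetric] by blast
qed

subsection \<open>Sliding windows\<close>

text \<open>The part of the interval from \<open>s - B\<close> to \<open>s - 1\<close> inside the
  row. With \<open>s\<close> running up to \<open>n + B\<close> the windows overhang both ends, so
  every index lies in exactly \<open>B\<close> of them and no boundary terms arise.\<close>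

definition sliding_window :: "nat \<Rightarrow> nat \<Rightarrow> nat \<Rightarrow> nat set" where
  "sliding_window n B s = {i. i < n \<and> i < s \<and> s \<le> i + B}"

lemma sliding_window_subset: "sliding_window n B s \<subseteq> {..<n}"
  by (auto simp: sliding_window_def)

lemma finite_sliding_window [simp]: "finite (sliding_window n B s)"
  by (simp add: sliding_window_def)

lemma card_sliding_window_le: "card (sliding_window n B s) \<le> B"
proof -
  have "sliding_window n B s \<subseteq> {s - B..<s}"
    by (auto simp: sliding_window_def)
  then have "card (sliding_window n B s) \<le> card {s - B..<s}"
    by (intro card_mono) auto
  then show ?thesis by simp
qed

lemma sum_sliding_window:
  fixes g :: "nat \<Rightarrow> real"
  shows "(\<Sum>i\<in>sliding_window n B s. g i) = (\<Sum>i<n. of_bool (i < s \<and> s \<le> i + B) * g i)"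
  by (rule sum.mono_neutral_cong_left) (auto simp: sliding_window_def)

text \<open>Both indices lie in window \<open>s\<close> iff \<open>max i j < s\<close> and
  \<open>s \<le> min i j + B\<close>. The truncated difference \<open>B - lag i j\<close> counts
  these \<open>s\<close>, and is 0 for pairs too far apart.\<close>

lemma sum_sum_sliding_windows:
  fixes f :: "nat \<Rightarrow> nat \<Rightarrow> real"
  shows "(\<Sum>s\<le>n + B. \<Sum>i\<in>sliding_window n B s. \<Sum>j\<in>sliding_window n B s. f i j)
    = (\<Sum>i<n. \<Sum>j<n. real (B - lag i j) * f i j)"
proof -
  let ?P = "\<lambda>i j s. (i < s \<and> s \<le> i + B) \<and> (j < s \<and> s \<le> j + B)"
  have "(\<Sum>s\<le>n + B. \<Sum>i\<in>sliding_window n B s. \<Sum>j\<in>sliding_window n B s. f i j)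
    = (\<Sum>s\<le>n + B. \<Sum>i<n. \<Sum>j<n. of_bool (?P i j s) * f i j)"
    by (simp only: sum_sliding_window sum_distrib_left of_bool_conj mult.assoc)
  also have "\<dots> = (\<Sum>i<n. \<Sum>j<n. \<Sum>s\<le>n + B. of_bool (?P i j s) * f i j)"
    by (rule sum_rotate)
  also have "\<dots> = (\<Sum>i<n. \<Sum>j<n. real (B - lag i j) * f i j)"
  proof (intro sum.cong[OF refl])
    fix i j assume "i \<in> {..<n}" "j \<in> {..<n}"
    have "(\<Sum>s\<le>n + B. of_bool (?P i j s) :: real) = (\<Sum>s\<in>{max i j<..min i j + B}. 1)"
      by (rule sum.mono_neutral_cong_right) (use \<open>i \<in> {..<n}\<close> in auto)
    also have "\<dots> = real (B - lag i j)"
      by (auto simp: lag_def max_def min_def)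
    finally show "(\<Sum>s\<le>n + B. of_bool (?P i j s) * f i j) = real (B - lag i j) * f i j"
      by (simp only: sum_distrib_right[symmetric])
  qed
  finally show ?thesis .
qed

lemma sum_sliding_windows:
  fixes g :: "nat \<Rightarrow> real"
  shows "(\<Sum>s\<le>n + B. \<Sum>i\<in>sliding_window n B s. g i) = real B * (\<Sum>i<n. g i)"
proof -
  have "(\<Sum>s\<le>n + B. \<Sum>i\<in>sliding_window n B s. \<Sum>j\<in>sliding_window n B s. of_bool (i = j) * g i)
    = (\<Sum>i<n. \<Sum>j<n. real (B - lag i j) * (of_bool (i = j) * g i))"
    by (rule sum_sum_sliding_windows)
  moreover have "(\<Sum>j\<in>W. of_bool (i = j) * g i) = g i" if "i \<in> W" "finite W" for i W
    using that by (simp add: of_bool_def if_distrib[of "\<lambda>x. x * _"] cong: if_cong)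
  moreover have "(\<Sum>j<n. real (B - lag i j) * (of_bool (i = j) * g i)) = real B * g i" if "i < n" for i
  proof -
    have "(\<Sum>j<n. real (B - lag i j) * (of_bool (i = j) * g i)) = (\<Sum>j<n. if i = j then real B * g i else 0)"
      by (intro sum.cong) auto
    then show ?thesis using that by simp
  qed
  ultimately show ?thesis
    by (simp add: sum_distrib_left)
qed

lemma sum_if_interval:
  fixes f :: "nat \<Rightarrow> real"
  assumes "p + B \<le> n"
  shows "(\<Sum>i<n. if i \<in> {p..<p + B} then f i else 0) = (\<Sum>i<B. f (p + i))"
proof -
  have "(\<Sum>i<n. if i \<in> {p..<p + B} then f i else 0) = (\<Sum>i\<in>{p..<p + B}. f i)"
    by (rule sum.mono_neutral_cong_right) (use assms in auto)
  also have "\<dots> = (\<Sum>i<B. f (p + i))"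
    by (rule sum.reindex_bij_witness[of _ "\<lambda>i. p + i" "\<lambda>i. i - p"]) auto
  finally show ?thesis .
qed

lemma quad_form_interval:
  assumes "p + B \<le> n"
  shows "quad_form A {..<n} (\<lambda>i. if i \<in> {p..<p + B} then g i else 0)
    = (\<Sum>i<B. \<Sum>j<B. A (p + i) (p + j) * g (p + i) * g (p + j))"
proof -
  let ?I = "{p..<p + B}"
  have "quad_form A {..<n} (\<lambda>i. if i \<in> ?I then g i else 0)
    = (\<Sum>i<n. if i \<in> ?I then (\<Sum>j<n. if j \<in> ?I then A i j * g i * g j else 0) else 0)"
    unfolding quad_form_def
    by (intro sum.cong[OF refl]) (auto intro!: sum.cong)
  then show ?thesis
    by (simp only: sum_if_interval[OF assms])
qed

subsection \<open>Locally Toeplitz matrices\<close>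

text \<open>\<open>S n\<close> plays the role of the covariance matrix of the \<open>n\<close>-th row, indexed from 0.\<close>

locale covariance_approximation =
  fixes S :: "nat \<Rightarrow> nat \<Rightarrow> nat \<Rightarrow> real" and \<gamma> :: "real \<Rightarrow> nat \<Rightarrow> real"
    and K L :: real and w :: "nat \<Rightarrow> real"
  assumes S_approx: "i < n \<Longrightarrow> j < n \<Longrightarrow>
      \<bar>S n i j - \<gamma> (real (Suc i) / real n) (lag i j)\<bar> \<le> K * ((real (lag i j) + 1) / real n)"
    and S_bound: "i < n \<Longrightarrow> j < n \<Longrightarrow> i \<noteq> j \<Longrightarrow> \<bar>S n i j\<bar> \<le> w (lag i j)"
    and lipschitz: "s \<in> {0..1} \<Longrightarrow> t \<in> {0..1} \<Longrightarrow> \<bar>\<gamma> s k - \<gamma> t k\<bar> \<le> L * \<bar>s - t\<bar>"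
    and L_nonneg: "0 \<le> L"
    and w_summable: "summable w"
    and w_nonneg: "0 \<le> w k"
begin

text \<open>This is \<open>n\<close> times the entrywise error inside a window: the \<open>K\<close>
  term comes from local stationarity at lags up to \<open>B\<close>, the \<open>L\<close> term from
  moving the time by at most \<open>B / n\<close>.\<close>

definition local_error :: "nat \<Rightarrow> real" where
  "local_error B = K * (real B + 1) + L * real B"

lemma K_nonneg: "0 \<le> K"
  \<comment> \<open>The instance \<open>n = 1\<close>, \<open>i = j = 0\<close>, where the bound
    equals \<open>K\<close>.\<close>
  using order.trans[OF abs_ge_zero S_approx[of 0 1 0]] by simp

lemma local_error_nonneg: "0 \<le> local_error B"
  using K_nonneg L_nonneg by (simp add: local_error_def)

lemma local_approx:
  assumes "i < n" "j < n" "lag i j \<le> B" "t \<in> {0..1}"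
    and near: "\<bar>real (Suc i) / real n - t\<bar> \<le> real B / real n"
  shows "\<bar>S n i j - \<gamma> t (lag i j)\<bar> \<le> local_error B / real n"
proof -
  have "\<bar>S n i j - \<gamma> (real (Suc i) / real n) (lag i j)\<bar> \<le> K * ((real (lag i j) + 1) / real n)"
    by (rule S_approx) fact+
  also have "\<dots> \<le> K * ((real B + 1) / real n)"
    using assms K_nonneg by (intro mult_left_mono divide_right_mono) auto
  finally have 1: "\<bar>S n i j - \<gamma> (real (Suc i) / real n) (lag i j)\<bar> \<le> K * ((real B + 1) / real n)" .
  have "\<bar>\<gamma> (real (Suc i) / real n) (lag i j) - \<gamma> t (lag i j)\<bar> \<le> L * \<bar>real (Suc i) / real n - t\<bar>"
    using assms by (intro lipschitz) auto
  also have "\<dots> \<le> L * (real B / real n)"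
    by (intro mult_left_mono near L_nonneg)
  finally have "\<bar>S n i j - \<gamma> t (lag i j)\<bar> \<le> K * ((real B + 1) / real n) + L * (real B / real n)"
    using 1 by linarith
  then show ?thesis
    by (simp add: local_error_def add_divide_distrib distrib_left)
qed

text \<open>The start \<open>t * (n - B)\<close>, rounded down, moves from 0 to \<open>n - B\<close>
  as \<open>t\<close> runs through the unit interval. The window thus stays inside the row even for
  \<open>t\<close> at an endpoint, and remains within \<open>B\<close> of
  \<open>t * n\<close>.\<close>

lemma ex_near_window:
  assumes "t \<in> {0..1}" "B \<le> n" "0 < n"
  shows "\<exists>p. p + B \<le> n \<and> (\<forall>i<B. \<bar>real (Suc (p + i)) / real n - t\<bar> \<le> real B / real n)"
proof -
  define p where "p = nat \<lfloor>t * (real n - real B)\<rfloor>"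
  have "0 \<le> t * (real n - real B)" using assms by simp
  then have p: "real p \<le> t * (real n - real B)" "t * (real n - real B) < real p + 1"
    unfolding p_def by linarith+
  have "t * (real n - real B) \<le> 1 * (real n - real B)"
    using assms by (intro mult_right_mono) auto
  with p(1) have "real (p + B) \<le> real n" by simp
  then have "p + B \<le> n" by (simp only: of_nat_le_iff)
  moreover have "\<bar>real (Suc (p + i)) / real n - t\<bar> \<le> real B / real n" if "i < B" for i
  proof -
    have tB: "0 \<le> t * real B" "t * real B \<le> real B"
      using assms(1) mult_left_le_one_le[of "real B" t] by auto
    have "real (Suc (p + i)) - t * real n \<le> real B" "- real B \<le> real (Suc (p + i)) - t * real n"
      using p tB that unfolding right_diff_distrib of_nat_Suc of_nat_add by linarith+
    then have "\<bar>real (Suc (p + i)) - t * real n\<bar> \<le> real B" by linarith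
    moreover have "real (Suc (p + i)) / real n - t = (real (Suc (p + i)) - t * real n) / real n"
      using \<open>0 < n\<close> by (simp add: field_simps)
    ultimately show ?thesis
      using \<open>0 < n\<close> by (simp add: abs_divide divide_right_mono)
  qed
  ultimately show ?thesis by blast
qed

lemma LIMSEQ_local_error: "(\<lambda>n. c * (local_error B / real n)) \<longlonglongrightarrow> 0"
  using tendsto_mult_right[OF lim_const_over_n, of c "local_error B"] by simp

text \<open>Short-range dependence concerns the covariances only. It passes to
  \<open>\<gamma>\<close> because entries at lag \<open>k\<close> near \<open>t\<close> converge to
  \<open>\<gamma> t k\<close>.\<close>

lemma \<gamma>_bound:
  assumes "t \<in> {0..1}" "k \<noteq> 0"
  shows "\<bar>\<gamma> t k\<bar> \<le> w k"
proof -
  have "(\<lambda>n. w k + 1 * (local_error (Suc k) / real n)) \<longlonglongrightarrow> w k + 0"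
    by (intro tendsto_intros LIMSEQ_local_error)
  moreover have "\<bar>\<gamma> t k\<bar> \<le> w k + 1 * (local_error (Suc k) / real n)" if n: "Suc k \<le> n" for n
  proof -
    obtain p where p: "p + Suc k \<le> n" "\<forall>i<Suc k. \<bar>real (Suc (p + i)) / real n - t\<bar> \<le> real (Suc k) / real n"
      using ex_near_window[OF assms(1) n] n by auto
    have lag: "lag (p + k) p = k" by (simp add: lag_eq_diff)
    have "\<bar>S n (p + k) p - \<gamma> t (lag (p + k) p)\<bar> \<le> local_error (Suc k) / real n"
      using p assms(1) lag by (intro local_approx) auto
    moreover have "\<bar>S n (p + k) p\<bar> \<le> w (lag (p + k) p)"
      using p assms(2) by (intro S_bound) auto
    ultimately show ?thesis unfolding lag by linarith
  qed
  ultimately show ?thesis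
    by (intro LIMSEQ_le_const[where X = "\<lambda>n. w k + 1 * (local_error (Suc k) / real n)"]) auto
qed

lemma \<gamma>_summable:
  assumes "t \<in> {0..1}"
  shows "summable (\<lambda>k. \<bar>\<gamma> t k\<bar>)"
  by (rule summable_comparison_test'[OF w_summable, of 1]) (use \<gamma>_bound[OF assms] in auto)

section \<open>From a lower bound on the symbol to one on the covariance form\<close>

lemma window_form_ge:
  assumes symbol: "\<And>t \<omega>. t \<in> {0..1} \<Longrightarrow> \<kappa> \<le> cos_series (\<gamma> t) \<omega>"
    and "0 < n"
  shows "(\<kappa> - real B * (local_error B / real n)) * (\<Sum>i\<in>sliding_window n B s. (a i)\<^sup>2)
    \<le> quad_form (S n) (sliding_window n B s) a"
proof -
  let ?W = "sliding_window n B s" and ?e = "local_error B / real n"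
  \<comment> \<open>The right end of the window, capped at \<open>n\<close> since the last windows
    overhang the row. In 1-based numbering every index of the window is within \<open>B\<close> of
    it.\<close>
  define t where "t = real (min s n) / real n"
  have t: "t \<in> {0..1}" using \<open>0 < n\<close> by (auto simp: t_def)
  have near: "\<bar>S n i j - \<gamma> t (lag i j)\<bar> \<le> ?e" if "i \<in> ?W" "j \<in> ?W" for i j
  proof (rule local_approx[OF _ _ _ t])
    have "\<bar>real (Suc i) - real (min s n)\<bar> \<le> real B"
      using that by (auto simp: sliding_window_def)
    then show "\<bar>real (Suc i) / real n - t\<bar> \<le> real B / real n"
      using \<open>0 < n\<close> by (simp add: t_def abs_divide divide_right_mono flip: diff_divide_distrib)
  qed (use that in \<open>auto simp: sliding_window_def lag_def\<close>)
  have e: "0 \<le> ?e" using local_error_nonneg by simp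
  \<comment> \<open>A row of the window has at most \<open>B\<close> entries, each with error at
    most \<open>?e\<close>, so Schur's test gives the constant \<open>real B * ?e\<close>.\<close>
  have "(\<Sum>i\<in>?W. \<Sum>j\<in>?W. ?e * \<bar>a i * a j\<bar>) \<le> real B * ?e * (\<Sum>i\<in>?W. (a i)\<^sup>2)"
  proof (rule sum_sum_mult_le)
    show "(\<Sum>j\<in>?W. ?e) \<le> real B * ?e"
      using mult_right_mono[OF _ e, of "real (card ?W)" "real B"] card_sliding_window_le[of n B s] by simp
  qed (use e in auto)
  moreover have "(\<Sum>i\<in>?W. \<Sum>j\<in>?W. \<gamma> t (lag i j) * a i * a j) - (\<Sum>i\<in>?W. \<Sum>j\<in>?W. ?e * \<bar>a i * a j\<bar>)
    \<le> quad_form (S n) ?W a"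
    unfolding quad_form_def sum_subtractf[symmetric]
  proof (intro sum_mono)
    fix i j assume "i \<in> ?W" "j \<in> ?W"
    then have "\<bar>S n i j - \<gamma> t (lag i j)\<bar> * \<bar>a i * a j\<bar> \<le> ?e * \<bar>a i * a j\<bar>"
      by (intro mult_right_mono near) auto
    then have "\<bar>(S n i j - \<gamma> t (lag i j)) * (a i * a j)\<bar> \<le> ?e * \<bar>a i * a j\<bar>"
      by (simp only: abs_mult)
    then show "\<gamma> t (lag i j) * a i * a j - ?e * \<bar>a i * a j\<bar> \<le> S n i j * a i * a j"
      unfolding left_diff_distrib mult.assoc by linarith
  qed
  moreover have "\<kappa> * (\<Sum>i\<in>?W. (a i)\<^sup>2) \<le> (\<Sum>i\<in>?W. \<Sum>j\<in>?W. \<gamma> t (lag i j) * a i * a j)"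
    by (rule toeplitz_form_ge[OF \<gamma>_summable[OF t] symbol[OF t] sliding_window_subset])
  ultimately show ?thesis
    by (simp only: left_diff_distrib)
qed

text \<open>The weight \<open>B\<close> splits into \<open>B - lag i j\<close>, truncated at 0, and
  \<open>min (lag i j) B\<close>. The first part is the sum over all windows. The second is
  controlled by Schur's test, with row sums at most \<open>2 * \<epsilon> * B\<close>.\<close>

lemma quad_form_ge:
  assumes symbol: "\<And>t \<omega>. t \<in> {0..1} \<Longrightarrow> \<kappa> \<le> cos_series (\<gamma> t) \<omega>"
    and "0 < n" "0 < B" and B: "(\<Sum>k. min (real k) (real B) * w k) \<le> \<epsilon> * real B"
  shows "(\<kappa> - real B * (local_error B / real n) - 2 * \<epsilon>) * (\<Sum>i<n. (a i)\<^sup>2) \<le> quad_form (S n) {..<n} a"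
proof -
  let ?N = "\<Sum>i<n. (a i)\<^sup>2" and ?c = "\<kappa> - real B * (local_error B / real n)"
  let ?u = "\<lambda>k. min (real k) (real B) * w k"
  have u: "0 \<le> ?u k" for k
    using w_nonneg by simp
  have "real B * (?c * ?N) = ?c * (\<Sum>s\<le>n + B. \<Sum>i\<in>sliding_window n B s. (a i)\<^sup>2)"
    by (simp only: sum_sliding_windows mult.left_commute)
  also have "\<dots> \<le> (\<Sum>s\<le>n + B. quad_form (S n) (sliding_window n B s) a)"
    unfolding sum_distrib_left[of ?c "\<lambda>s. \<Sum>i\<in>sliding_window n B s. (a i)\<^sup>2"]
    by (intro sum_mono window_form_ge symbol \<open>0 < n\<close>)
  also have "\<dots> = (\<Sum>i<n. \<Sum>j<n. real (B - lag i j) * (S n i j * a i * a j))"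
    unfolding quad_form_def by (rule sum_sum_sliding_windows)
  finally have windows: "real B * (?c * ?N) \<le> (\<Sum>i<n. \<Sum>j<n. real (B - lag i j) * (S n i j * a i * a j))" .
  have "(\<Sum>i<n. \<Sum>j<n. ?u (lag i j) * \<bar>a i * a j\<bar>) \<le> 2 * (\<Sum>k<n. ?u k) * ?N"
  proof (rule sum_sum_mult_le)
    show "(\<Sum>j<n. ?u (lag i j)) \<le> 2 * (\<Sum>k<n. ?u k)" if "i \<in> {..<n}" for i
      by (rule sum_lag_le) (use that u in auto)
  qed (use u lag_commute in auto)
  also have "\<dots> \<le> 2 * (\<epsilon> * real B) * ?N"
    using order.trans[OF sum_le_suminf[OF summable_min_mult[OF w_summable w_nonneg]] B, of "{..<n}"] u
    by (intro mult_right_mono mult_left_mono sum_nonneg) auto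
  finally have error: "(\<Sum>i<n. \<Sum>j<n. ?u (lag i j) * \<bar>a i * a j\<bar>) \<le> 2 * (\<epsilon> * real B) * ?N" .
  have "(\<Sum>i<n. \<Sum>j<n. real (B - lag i j) * (S n i j * a i * a j))
      - (\<Sum>i<n. \<Sum>j<n. ?u (lag i j) * \<bar>a i * a j\<bar>) \<le> real B * quad_form (S n) {..<n} a"
    unfolding quad_form_def sum_distrib_left sum_subtractf[symmetric]
  proof (intro sum_mono)
    fix i j assume "i \<in> {..<n}" "j \<in> {..<n}"
    \<comment> \<open>\<open>S_bound\<close> covers only \<open>i \<noteq> j\<close>; on the
      diagonal the factor \<open>min\<close> is 0.\<close>
    have "min (real (lag i j)) (real B) * \<bar>S n i j\<bar> \<le> ?u (lag i j)"
      using S_bound[of i n j] \<open>i \<in> {..<n}\<close> \<open>j \<in> {..<n}\<close>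
      by (cases "i = j") (auto intro!: mult_left_mono)
    then have "min (real (lag i j)) (real B) * \<bar>S n i j\<bar> * \<bar>a i * a j\<bar> \<le> ?u (lag i j) * \<bar>a i * a j\<bar>"
      by (intro mult_right_mono) auto
    then have "\<bar>min (real (lag i j)) (real B) * (S n i j * (a i * a j))\<bar> \<le> ?u (lag i j) * \<bar>a i * a j\<bar>"
      by (simp add: abs_mult mult.assoc)
    moreover have "real B * (S n i j * (a i * a j))
      = real (B - lag i j) * (S n i j * (a i * a j)) + min (real (lag i j)) (real B) * (S n i j * (a i * a j))"
    proof -
      have "real B = real (B - lag i j) + min (real (lag i j)) (real B)" by auto
      then show ?thesis by (metis distrib_right)
    qed
    ultimately show "real (B - lag i j) * (S n i j * a i * a j) - ?u (lag i j) * \<bar>a i * a j\<bar>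
      \<le> real B * (S n i j * a i * a j)"
      unfolding mult.assoc[of "S n i j"] by linarith
  qed
  with windows error have "real B * (?c * ?N) - 2 * (\<epsilon> * real B) * ?N \<le> real B * quad_form (S n) {..<n} a"
    by linarith
  then have "real B * ((?c - 2 * \<epsilon>) * ?N) \<le> real B * quad_form (S n) {..<n} a"
    by (simp add: algebra_simps)
  then show ?thesis
    using \<open>0 < B\<close> by (simp only: mult_le_cancel_left_pos of_nat_0_less_iff)
qed

lemma eventually_quad_form_ge:
  assumes symbol: "\<And>t \<omega>. t \<in> {0..1} \<Longrightarrow> \<kappa> \<le> cos_series (\<gamma> t) \<omega>" and "0 < \<kappa>"
  shows "\<forall>\<^sub>F n in sequentially. \<forall>a. \<kappa> / 2 * (\<Sum>i<n. (a i)\<^sup>2) \<le> quad_form (S n) {..<n} a"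
proof -
  \<comment> \<open>The remainder costs \<open>2 * (\<kappa> / 8)\<close> and the local error below
    costs less than \<open>\<kappa> / 4\<close>, which leaves \<open>\<kappa> / 2\<close>.
    \<open>B\<close> is fixed before \<open>n\<close> grows.\<close>
  obtain B where B: "0 < B" "(\<Sum>k. min (real k) (real B) * w k) \<le> \<kappa> / 8 * real B"
    using ex_suminf_min_le[OF w_summable w_nonneg, of "\<kappa> / 8"] \<open>0 < \<kappa>\<close> by auto
  have "\<forall>\<^sub>F n in sequentially. real B * (local_error B / real n) < \<kappa> / 4"
    by (rule order_tendstoD[OF LIMSEQ_local_error]) (use \<open>0 < \<kappa>\<close> in simp)
  then show ?thesis
    using eventually_gt_at_top[of 0]
  proof eventually_elim
    case (elim n)
    show ?case
    proof
      fix a :: "nat \<Rightarrow> real"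
      have "\<kappa> / 2 * (\<Sum>i<n. (a i)\<^sup>2)
        \<le> (\<kappa> - real B * (local_error B / real n) - 2 * (\<kappa> / 8)) * (\<Sum>i<n. (a i)\<^sup>2)"
        using elim by (intro mult_right_mono sum_nonneg) auto
      also have "\<dots> \<le> quad_form (S n) {..<n} a"
        using elim B by (intro quad_form_ge symbol) auto
      finally show "\<kappa> / 2 * (\<Sum>i<n. (a i)\<^sup>2) \<le> quad_form (S n) {..<n} a" .
    qed
  qed
qed

section \<open>The converse: Fejer means of the spectral density\<close>

lemma toeplitz_cos_sum_ge:
  assumes ev: "\<forall>\<^sub>F n in sequentially. \<forall>a. \<kappa> * (\<Sum>i<n. (a i)\<^sup>2) \<le> quad_form (S n) {..<n} a"
    and t: "t \<in> {0..1}"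
  shows "\<kappa> * real B \<le> (\<Sum>i<B. \<Sum>j<B. \<gamma> t (lag i j) * cos (real (lag i j) * \<omega>))" (is "_ \<le> ?G")
proof -
  have "\<forall>\<^sub>F n in sequentially. \<kappa> * real B \<le> ?G + (real B)\<^sup>2 * (local_error B / real n)"
    using ev eventually_ge_at_top[of B] eventually_gt_at_top[of 0]
  proof eventually_elim
    case (elim n)
    obtain p where p: "p + B \<le> n" "\<forall>i<B. \<bar>real (Suc (p + i)) / real n - t\<bar> \<le> real B / real n"
      using ex_near_window[OF t elim(2,3)] by blast
    let ?a = "\<lambda>g i. if i \<in> {p..<p + B} then g (real i * \<omega>) else 0"
    have sq: "(\<Sum>i<n. (?a g i)\<^sup>2) = (\<Sum>i<B. (g (real (p + i) * \<omega>))\<^sup>2)" for g :: "real \<Rightarrow> real"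
      using sum_if_interval[OF p(1), of "\<lambda>i. (g (real i * \<omega>))\<^sup>2"]
      by (simp only: if_distrib[of "\<lambda>x. x\<^sup>2"] zero_power2)
    \<comment> \<open>The squares of cosine and sine add up to 1 at each of the \<open>B\<close>
      indices.\<close>
    have "\<kappa> * real B = \<kappa> * ((\<Sum>i<n. (?a cos i)\<^sup>2) + (\<Sum>i<n. (?a sin i)\<^sup>2))"
      unfolding sq sum.distrib[symmetric] by simp
    also have "\<dots> \<le> quad_form (S n) {..<n} (?a cos) + quad_form (S n) {..<n} (?a sin)"
      unfolding distrib_left
      by (intro add_mono elim(1)[rule_format, of "?a cos"] elim(1)[rule_format, of "?a sin"])
    \<comment> \<open>Adding the two forms leaves the cosine of a phase difference, so the window
      position \<open>p\<close> drops out of the angle.\<close>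
    also have "\<dots> = (\<Sum>i<B. \<Sum>j<B. S n (p + i) (p + j) * cos (real (lag i j) * \<omega>))"
      unfolding quad_form_interval[OF p(1)] sum.distrib[symmetric]
      by (intro sum.cong[OF refl], subst lag_add_left[of p, symmetric])
        (simp only: cos_lag distrib_left mult.assoc)
    also have "\<dots> \<le> (\<Sum>i<B. \<Sum>j<B. \<gamma> t (lag i j) * cos (real (lag i j) * \<omega>) + local_error B / real n)"
    proof (intro sum_mono)
      fix i j assume "i \<in> {..<B}" "j \<in> {..<B}"
      then have "\<bar>S n (p + i) (p + j) - \<gamma> t (lag (p + i) (p + j))\<bar> \<le> local_error B / real n"
        using p t by (intro local_approx) (auto intro: less_imp_le lag_less)
      then have "\<bar>S n (p + i) (p + j) - \<gamma> t (lag i j)\<bar> * \<bar>cos (real (lag i j) * \<omega>)\<bar> \<le> local_error B / real n * 1"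
        by (intro mult_mono) auto
      then have "\<bar>(S n (p + i) (p + j) - \<gamma> t (lag i j)) * cos (real (lag i j) * \<omega>)\<bar> \<le> local_error B / real n"
        by (simp only: abs_mult mult_1_right)
      then show "S n (p + i) (p + j) * cos (real (lag i j) * \<omega>)
        \<le> \<gamma> t (lag i j) * cos (real (lag i j) * \<omega>) + local_error B / real n"
        unfolding left_diff_distrib by linarith
    qed
    also have "\<dots> = ?G + (real B)\<^sup>2 * (local_error B / real n)"
      by (simp add: sum.distrib power2_eq_square)
    finally show ?case .
  qed
  moreover have "(\<lambda>n. ?G + (real B)\<^sup>2 * (local_error B / real n)) \<longlonglongrightarrow> ?G + 0"
    by (intro tendsto_intros LIMSEQ_local_error)
  ultimately show ?thesis
    using tendsto_lowerbound[of _ "?G + 0" sequentially "\<kappa> * real B"] by simp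
qed

text \<open>The Fejer weights \<open>B - k\<close> differ from \<open>B\<close> by
  \<open>min k B\<close>, so the form differs from \<open>B\<close> times the series by at most
  \<open>2 * (\<Sum>k. min k B * w k)\<close>, which is at most
  \<open>\<epsilon> * B\<close>.\<close>

lemma cos_series_ge:
  assumes ev: "\<forall>\<^sub>F n in sequentially. \<forall>a. \<kappa> * (\<Sum>i<n. (a i)\<^sup>2) \<le> quad_form (S n) {..<n} a"
    and t: "t \<in> {0..1}"
  shows "\<kappa> \<le> cos_series (\<gamma> t) \<omega>"
proof (rule field_le_epsilon)
  fix \<epsilon> :: real assume "0 < \<epsilon>"
  then obtain B where B: "0 < B" "(\<Sum>k. min (real k) (real B) * w k) \<le> \<epsilon> / 2 * real B"
    using ex_suminf_min_le[OF w_summable w_nonneg, of "\<epsilon> / 2"] by auto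
  define u where "u k = lag_mult k * \<gamma> t k * cos (real k * \<omega>)" for k
  have u: "summable u"
    unfolding u_def by (rule summable_cos_series[OF \<gamma>_summable[OF t]])
  define m where "m k = 2 * (min (real k) (real B) * w k)" for k
  have m: "summable m"
    unfolding m_def by (intro summable_mult summable_min_mult w_summable w_nonneg)
  have "\<kappa> * real B \<le> (\<Sum>i<B. \<Sum>j<B. \<gamma> t (lag i j) * cos (real (lag i j) * \<omega>))"
    by (rule toeplitz_cos_sum_ge[OF ev t])
  also have "\<dots> = (\<Sum>k<B. lag_mult k * (real B - real k) * (\<gamma> t k * cos (real k * \<omega>)))"
    by (rule sum_sum_lag)
  also have "\<dots> = (\<Sum>k<B. (real B - min (real k) (real B)) * u k)"
    by (intro sum.cong) (auto simp: u_def)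
  \<comment> \<open>For \<open>k \<ge> B\<close> the weight vanishes, so the finite sum is already a
    series.\<close>
  also have "\<dots> = (\<Sum>k. (real B - min (real k) (real B)) * u k)"
    by (rule suminf_finite[symmetric]) auto
  also have "\<dots> \<le> (\<Sum>k. real B * u k + m k)"
  proof (rule suminf_le)
    fix k
    have "\<bar>u k\<bar> * min (real k) (real B) \<le> 2 * w k * min (real k) (real B)"
    proof (cases "k = 0")
      case False
      then have "\<bar>u k\<bar> \<le> 2 * w k"
        using abs_cos_series_term_le[of k "\<gamma> t" \<omega>] \<gamma>_bound[OF t False] unfolding u_def by linarith
      then show ?thesis by (intro mult_right_mono) auto
    qed simp
    then have "\<bar>u k * min (real k) (real B)\<bar> \<le> m k"
      by (simp add: m_def abs_mult mult_ac)
    moreover have "(real B - min (real k) (real B)) * u k = real B * u k - u k * min (real k) (real B)"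
      by (simp add: algebra_simps)
    ultimately show "(real B - min (real k) (real B)) * u k \<le> real B * u k + m k"
      by linarith
  next
    show "summable (\<lambda>k. (real B - min (real k) (real B)) * u k)"
      by (rule summable_finite[of "{..<B}"]) auto
    show "summable (\<lambda>k. real B * u k + m k)"
      by (intro summable_add summable_mult u m)
  qed
  also have "\<dots> = real B * cos_series (\<gamma> t) \<omega> + (\<Sum>k. m k)"
    unfolding cos_series_def u_def[symmetric]
    by (simp add: suminf_add[symmetric] suminf_mult summable_mult u m)
  also have "(\<Sum>k. m k) = 2 * (\<Sum>k. min (real k) (real B) * w k)"
    unfolding m_def by (intro suminf_mult summable_min_mult w_summable w_nonneg)
  also have "\<dots> \<le> \<epsilon> * real B" using B by simp
  finally have "\<kappa> * real B \<le> (cos_series (\<gamma> t) \<omega> + \<epsilon>) * real B"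
    by (simp add: algebra_simps)
  then show "\<kappa> \<le> cos_series (\<gamma> t) \<omega> + \<epsilon>"
    using \<open>0 < B\<close> by simp
qed

end

theorem proposition2p9:
  fixes M :: "nat \<Rightarrow> 'a measure"
    and x :: "nat \<Rightarrow> nat \<Rightarrow> 'a \<Rightarrow> real"
    and \<gamma> :: "real \<Rightarrow> nat \<Rightarrow> real"
    and \<tau> :: real
  assumes "triangular_array M x"
    and "locally_stationary M x \<gamma>"
    and "\<tau> > 1"
    and "short_range_dependent M x \<tau>"
  shows "((\<exists>\<kappa>>0. \<forall>t\<in>{0..1}. \<forall>\<omega>::real. complex_of_real \<kappa> \<le> spectral_density \<gamma> t \<omega>)
            \<longrightarrow> UPDC M x) \<and>
         (UPDC M x \<longrightarrow>
            (\<exists>\<kappa>>0. \<forall>t\<in>{0..1}. \<forall>\<omega>::real. complex_of_real \<kappa> \<le> spectral_density \<gamma> t \<omega>))"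
proof -
  define S where "S n i j = covariance (M n) (x (Suc i) n) (x (Suc j) n)" for n i j
  obtain K where K: "\<And>n i j. i \<in> {1..n} \<Longrightarrow> j \<in> {1..n} \<Longrightarrow>
      \<bar>covariance (M n) (x i n) (x j n) - \<gamma> (real i / real n) (nat \<bar>int i - int j\<bar>)\<bar>
        \<le> K * ((\<bar>real i - real j\<bar> + 1) / real n)"
    using assms(2) unfolding locally_stationary_def by blast
  obtain L where L: "\<And>k. L-lipschitz_on {0..1} (\<lambda>t. \<gamma> t k)"
    using assms(2) unfolding locally_stationary_def by blast
  obtain C where "C > 0" and C: "\<forall>n. \<forall>k\<in>{1..n}. \<forall>r\<in>{- int k + 1..int n - int k}. r \<noteq> 0 \<longrightarrow>
      \<bar>covariance (M n) (x k n) (x (nat (int k + r)) n)\<bar> \<le> C * real_of_int \<bar>r\<bar> powr (- \<tau>)"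
    using assms(4) unfolding short_range_dependent_def by (elim conjE exE) (rule that)
  \<comment> \<open>At lag 0 \<open>powr\<close> yields 0, which is no bound on a variance; the
    locale compares \<open>S\<close> with \<open>w\<close> only off the diagonal.\<close>
  interpret covariance_approximation S \<gamma> K L "\<lambda>k. C * real k powr (- \<tau>)"
  proof
    show "\<bar>S n i j - \<gamma> (real (Suc i) / real n) (lag i j)\<bar> \<le> K * ((real (lag i j) + 1) / real n)"
      if "i < n" "j < n" for n i j
      using K[of "Suc i" n "Suc j"] that unfolding S_def real_lag by (simp add: lag_def)
    show "\<bar>S n i j\<bar> \<le> C * real (lag i j) powr (- \<tau>)" if "i < n" "j < n" "i \<noteq> j" for n i j
    proof -
      have "nat (int (Suc i) + (int j - int i)) = Suc j" by simp
      moreover have "real_of_int \<bar>int j - int i\<bar> = real (lag i j)"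
        by (simp add: real_lag abs_minus_commute)
      ultimately show ?thesis
        using C[rule_format, of "Suc i" n "int j - int i"] that unfolding S_def by simp
    qed
    show "\<bar>\<gamma> s k - \<gamma> t k\<bar> \<le> L * \<bar>s - t\<bar>" if "s \<in> {0..1}" "t \<in> {0..1}" for s t k
      using lipschitz_onD[OF L that, of k] by (simp add: dist_real_def)
    show "0 \<le> L" by (rule lipschitz_on_nonneg[OF L])
    show "summable (\<lambda>k. C * real k powr (- \<tau>))"
      using \<open>\<tau> > 1\<close> by (intro summable_mult) (simp add: summable_real_powr_iff)
    show "0 \<le> C * real k powr (- \<tau>)" for k using \<open>C > 0\<close> by simp
  qed
  have sym: "S n i j = S n j i" for n i j
    by (simp add: S_def covariance_def mult.commute)
  have density: "complex_of_real \<kappa> \<le> spectral_density \<gamma> t \<omega> \<longleftrightarrow> \<kappa> \<le> cos_series (\<gamma> t) \<omega>"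
    if "t \<in> {0..1}" for \<kappa> t \<omega>
    by (simp add: spectral_density_eq_cos_series[of \<gamma>, OF \<gamma>_summable[OF that]] less_eq_complex_def)
  have UPDC_iff: "UPDC M x \<longleftrightarrow>
    (\<exists>\<kappa>>0. \<forall>\<^sub>F n in sequentially. \<forall>a. \<kappa> * (\<Sum>i<n. (a i)\<^sup>2) \<le> quad_form (S n) {..<n} a)"
  proof -
    have "(\<forall>\<^sub>F n in sequentially. \<kappa> \<le> smallest_eigenvalue (covariance_matrix M x n)) \<longleftrightarrow>
      (\<forall>\<^sub>F n in sequentially. \<forall>a. \<kappa> * (\<Sum>i<n. (a i)\<^sup>2) \<le> quad_form (S n) {..<n} a)" for \<kappa>
    proof (rule eventually_cong)
      \<comment> \<open>For \<open>n = 0\<close> the spectrum is empty and \<open>Min\<close>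
        carries no information.\<close>
      show "\<forall>\<^sub>F n in sequentially. 0 < n" by (rule eventually_gt_at_top)
      show "\<kappa> \<le> smallest_eigenvalue (covariance_matrix M x n) \<longleftrightarrow>
        (\<forall>a. \<kappa> * (\<Sum>i<n. (a i)\<^sup>2) \<le> quad_form (S n) {..<n} a)" if "0 < n" for n
        unfolding covariance_matrix_def S_def[symmetric]
        using smallest_eigenvalue_ge_iff[OF that sym] .
    qed
    then show ?thesis unfolding UPDC_def by simp
  qed
  have "UPDC M x" if "\<kappa> > 0" "\<forall>t\<in>{0..1}. \<forall>\<omega>::real. complex_of_real \<kappa> \<le> spectral_density \<gamma> t \<omega>" for \<kappa>
    unfolding UPDC_iff using eventually_quad_form_ge[of \<kappa>] that density
    by (intro exI[of _ "\<kappa> / 2"]) auto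
  moreover have "\<exists>\<kappa>>0. \<forall>t\<in>{0..1}. \<forall>\<omega>::real. complex_of_real \<kappa> \<le> spectral_density \<gamma> t \<omega>" if "UPDC M x"
    using that cos_series_ge density unfolding UPDC_iff by blast
  ultimately show ?thesis by blast
qed

end
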